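(* Let $D$ be a domain in $\mathbb C$ that has a finite universal set for the infinitesimal Carathéodory extremal problem. Then $D$ has a universal set (for the infinitesimal Carathéodory extremal problem) consisting of one element. In particular, if $D$ is additionally $c$-finitely compact, then $D$ is biholomorphic to the unit disc $\mathbb D$.
   Context: $\mathbb D$ is the open unit disc, $\rho$ the hyperbolic (Poincaré) distance on $\mathbb D$, $\mathcal O(D,\mathbb D)$ the set of holomorphic functions $D\to\mathbb D$. For a domain $D\subset\mathbb C^n$: $c_D(z,w)=\sup\{\rho(F(z),F(w)):F\in\mathcal O(D,\mathbb D)\}$ is the Carathéodory pseudodistance, and $\gamma_D(w;X)=\sup\{|F'(w)X|: F \text{ holomorphic on } D,\ |F|\le 1,\ F(w)=0\}$ ($w\in D$, $X\in\mathbb C^n$) is the Carathéodory–Reiffen pseudometric; in particular $\gamma_{\mathbb D}(\lambda;Y)=|Y|/(1-|\lambda|^2)$. A set $\mathcal C\subset\mathcal O(D,\mathbb D)$ is a universal set for the infinitesimal Carathéodory extremal problem if for every $w\in D$ and $X\in\mathbb C^n\setminus\{0\}$ there is $F\in\mathcal C$ with $\gamma_D(w;X)=\gamma_{\mathbb D}(F(w);F'(w)X)$. $D$ is $c$-finitely compact if the Carathéodory balls $\{z\in D:c_D(w,z)<r\}$ are relatively compact in $D$ for all $w\in D$ and $r>0$. *)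

theory Defs
  imports "HOL-Complex_Analysis.Complex_Analysis"
begin

definition complex_domain :: "complex set \<Rightarrow> bool" where
  "complex_domain D \<longleftrightarrow> open D \<and> connected D \<and> D \<noteq> {}"

(* Holomorphic maps D -> E. As functions are total, only their values on D matter. *)
definition holo_maps :: "complex set \<Rightarrow> complex set \<Rightarrow> (complex \<Rightarrow> complex) set" where
  "holo_maps D E = {F. F holomorphic_on D \<and> F ` D \<subseteq> E}"

abbreviation unit_disc :: "complex set" where
  "unit_disc \<equiv> ball 0 1"

(* Poincare distance, normalised (without a factor 2) so that its infinitesimal
   form at z is |dz| / (1 - |z|^2), the Caratheodory-Reiffen metric of the disc. *)
definition hyp_dist :: "complex \<Rightarrow> complex \<Rightarrow> real" where
  "hyp_dist z w = artanh (cmod ((z - w) / (1 - cnj w * z)))"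

(* For a domain D and z, w in D both suprema below are over nonempty sets that are
   bounded above (by chains of discs and the Schwarz-Pick lemma, respectively by
   Cauchy's estimate), so the real-valued Sup is the true supremum. *)
definition carath_dist :: "complex set \<Rightarrow> complex \<Rightarrow> complex \<Rightarrow> real" where
  "carath_dist D z w = (SUP F \<in> holo_maps D unit_disc. hyp_dist (F z) (F w))"

definition carath_reiffen :: "complex set \<Rightarrow> complex \<Rightarrow> complex \<Rightarrow> real" where
  "carath_reiffen D w X =
     (SUP F \<in> {F \<in> holo_maps D (cball 0 1). F w = 0}. cmod (deriv F w * X))"

definition universal_set_inf_carath ::
    "complex set \<Rightarrow> (complex \<Rightarrow> complex) set \<Rightarrow> bool" where
  "universal_set_inf_carath D C \<longleftrightarrow>
     C \<subseteq> holo_maps D unit_disc \<and>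
     (\<forall>w\<in>D. \<forall>X. X \<noteq> 0 \<longrightarrow>
        (\<exists>F\<in>C. carath_reiffen D w X = carath_reiffen unit_disc (F w) (deriv F w * X)))"

definition relatively_compact_in :: "complex set \<Rightarrow> complex set \<Rightarrow> bool" where
  "relatively_compact_in B D \<longleftrightarrow> compact (closure B) \<and> closure B \<subseteq> D"

definition c_finitely_compact :: "complex set \<Rightarrow> bool" where
  "c_finitely_compact D \<longleftrightarrow>
     (\<forall>w\<in>D. \<forall>r>0. relatively_compact_in {z \<in> D. carath_dist D w z < r} D)"

definition biholomorphic :: "complex set \<Rightarrow> complex set \<Rightarrow> bool" where
  "biholomorphic D E \<longleftrightarrow>
     (\<exists>f\<in>holo_maps D E. \<exists>g\<in>holo_maps E D.
        (\<forall>z\<in>D. g (f z) = z) \<and> (\<forall>w\<in>E. f (g w) = w))"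

end

(*
  The extremal function of the Caratheodory-Reiffen problem at a point is unique up to rotation.
  Hence if two members of the universal set are extremal at a common point, they differ by an
  automorphism of the disc and are extremal at the same points. The loci of extremality of the
  members are closed in D, because a finite maximum of continuous functions is continuous; D is
  connected, so one of them is all of D.

  If D is c-finitely compact, the resulting F is a local isometry from the Caratheodory-Reiffen
  metric of D to the hyperbolic metric. A local right inverse of F on a disc of radius r < 1 does not increase distances to the centre
  (measured with the Caratheodory distance in D), so it stays in a compact subset of D and extends
  to a larger disc. The resulting right inverse on the unit disc has an image that is open and
  closed in D.
*)
theory Submission
  imports Defs
begin

section \<open>Hyperbolic derivative and its invariance under disc automorphisms\<close>

text \<open>For \<open>F\<close> with values in the disc this is the density at \<open>z\<close> of
  the pull-back under \<open>F\<close> of the Poincare metric.\<close>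

definition hyp_deriv :: "(complex \<Rightarrow> complex) \<Rightarrow> complex \<Rightarrow> real" where
  "hyp_deriv F z = cmod (deriv F z) / (1 - (cmod (F z))\<^sup>2)"

lemma one_minus_cnj_mult_nz:
  assumes "cmod a < 1" "cmod z < 1"
  shows "1 - cnj a * z \<noteq> 0"
proof
  assume "1 - cnj a * z = 0"
  then have "cmod a * cmod z = 1"
    by (metis complex_mod_cnj norm_mult norm_one right_minus_eq)
  moreover have "cmod a * cmod z < 1 * 1"
    using assms by (intro mult_strict_mono') auto
  ultimately show False by simp
qed

lemma one_minus_norm_Moebius_square:
  assumes "cmod a < 1" "cmod z < 1"
  shows "1 - (cmod (Moebius_function 0 a z))\<^sup>2 =
    (1 - (cmod a)\<^sup>2) * (1 - (cmod z)\<^sup>2) / (cmod (1 - cnj a * z))\<^sup>2"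
proof -
  have "(cmod (1 - cnj a * z))\<^sup>2 - (cmod (z - a))\<^sup>2 = (1 - (cmod a)\<^sup>2) * (1 - (cmod z)\<^sup>2)"
    unfolding cmod_power2 by (simp add: power2_eq_square) algebra
  moreover have "(cmod (1 - cnj a * z))\<^sup>2 \<noteq> 0"
    using one_minus_cnj_mult_nz[OF assms] by simp
  ultimately show ?thesis
    by (simp add: Moebius_function_simple norm_divide power_divide field_simps)
qed

lemma has_field_derivative_Moebius:
  assumes "cmod a < 1" "cmod z < 1"
  shows "(Moebius_function 0 a has_field_derivative (1 - (cmod a)\<^sup>2) / (1 - cnj a * z)\<^sup>2) (at z)"
proof -
  have eq: "(complex_of_real (cmod a))\<^sup>2 = a * cnj a"
    using complex_norm_square[of a] by simp
  have nz: "1 - cnj a * z \<noteq> 0"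
    using one_minus_cnj_mult_nz[OF assms] .
  have "((\<lambda>z. (z - a) / (1 - cnj a * z)) has_field_derivative
      (1 - (cmod a)\<^sup>2) / (1 - cnj a * z)\<^sup>2) (at z)"
    using nz eq
    by (auto intro!: derivative_eq_intros simp: divide_simps power2_eq_square) (simp add: algebra_simps)
  then show ?thesis
    by (simp add: Moebius_function_simple[abs_def])
qed

lemma Moebius_comp_holo_maps:
  assumes "cmod a < 1" "F \<in> holo_maps D unit_disc"
  shows "Moebius_function 0 a \<circ> F \<in> holo_maps D unit_disc"
proof -
  have F: "F holomorphic_on D" "F ` D \<subseteq> unit_disc" using assms(2) by (auto simp: holo_maps_def)
  then have "Moebius_function 0 a \<circ> F holomorphic_on D"
    by (rule holomorphic_on_compose_gen[OF _ Moebius_function_holomorphic[OF assms(1)]])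
  moreover have "cmod (Moebius_function 0 a (F z)) < 1" if "z \<in> D" for z
    using F that by (intro Moebius_function_norm_lt_1 assms) auto
  ultimately show ?thesis by (auto simp: holo_maps_def)
qed

text \<open>Disc automorphisms are isometries of the Poincare metric: the factor from
  \<open>has_field_derivative_Moebius\<close> cancels against the one in
  \<open>one_minus_norm_Moebius_square\<close>. Every later normalisation to a zero at a chosen
  point rests on this.\<close>

lemma hyp_deriv_Moebius_comp:
  assumes "open D" "z \<in> D" "F \<in> holo_maps D unit_disc" "cmod a < 1"
  shows "hyp_deriv (Moebius_function 0 a \<circ> F) z = hyp_deriv F z"
proof -
  have Fz: "cmod (F z) < 1" and F: "(F has_field_derivative deriv F z) (at z)"
    using assms by (auto simp: holo_maps_def intro: holomorphic_derivI)
  have "((Moebius_function 0 a \<circ> F) has_field_derivative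
     (1 - (cmod a)\<^sup>2) / (1 - cnj a * F z)\<^sup>2 * deriv F z) (at z)"
    by (rule DERIV_chain[OF has_field_derivative_Moebius[OF assms(4) Fz] F])
  then have d: "deriv (Moebius_function 0 a \<circ> F) z = (1 - (cmod a)\<^sup>2) / (1 - cnj a * F z)\<^sup>2 * deriv F z"
    by (rule DERIV_imp_deriv)
  have a: "(cmod a)\<^sup>2 < 1" and b: "(cmod (F z))\<^sup>2 < 1"
    using assms(4) Fz by (simp_all add: power_less_one_iff abs_square_less_1)
  have "cmod (1 - complex_of_real ((cmod a)\<^sup>2)) = 1 - (cmod a)\<^sup>2"
    using a by (metis abs_of_pos diff_gt_0_iff_gt norm_of_real of_real_1 of_real_diff)
  moreover have "cmod (1 - cnj a * F z) \<noteq> 0"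
    using one_minus_cnj_mult_nz[OF assms(4) Fz] by simp
  ultimately show ?thesis
    unfolding hyp_deriv_def d
    using a b
    by (simp add: one_minus_norm_Moebius_square[OF assms(4) Fz] norm_mult norm_divide norm_power)
qed

lemma hyp_deriv_zero:
  "F z = 0 \<Longrightarrow> hyp_deriv F z = cmod (deriv F z)"
  by (simp add: hyp_deriv_def)

lemma continuous_on_hyp_deriv:
  assumes "open D" "F \<in> holo_maps D unit_disc"
  shows "continuous_on D (hyp_deriv F)"
proof -
  have "(cmod (F z))\<^sup>2 \<noteq> 1" if "z \<in> D" for z
  proof -
    have "cmod (F z) < 1" using that assms(2) by (auto simp: holo_maps_def)
    then have "(cmod (F z))\<^sup>2 < 1" by (simp add: power_less_one_iff abs_square_less_1)
    then show ?thesis by simp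
  qed
  moreover have "continuous_on D (deriv F)" "continuous_on D F"
    using assms by (auto simp: holo_maps_def intro: holomorphic_on_imp_continuous_on holomorphic_deriv)
  ultimately show ?thesis
    unfolding hyp_deriv_def[abs_def] by (auto intro!: continuous_intros)
qed

section \<open>Extremality and the Caratheodory-Reiffen metric\<close>

text \<open>
  Up to a Moebius transformation moving \<open>F w\<close> to 0, this says that \<open>F\<close> attains the supremum in the
  Caratheodory-Reiffen metric at \<open>w\<close>.
\<close>

definition carath_extremal :: "complex set \<Rightarrow> (complex \<Rightarrow> complex) \<Rightarrow> complex \<Rightarrow> bool" where
  "carath_extremal D F w \<longleftrightarrow>
     (\<forall>f\<in>holo_maps D (cball 0 1). f w = 0 \<longrightarrow> cmod (deriv f w) \<le> hyp_deriv F w)"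

lemma holo_maps_mono: "E \<subseteq> E' \<Longrightarrow> F \<in> holo_maps D E \<Longrightarrow> F \<in> holo_maps D E'"
  by (auto simp: holo_maps_def)

text \<open>Extremality tests only functions vanishing at \<open>w\<close>; a Moebius map moves
  \<open>G w\<close> to 0 without changing \<open>hyp_deriv\<close>.\<close>

lemma carath_extremal_hyp_deriv_le:
  assumes "open D" "w \<in> D" "carath_extremal D F w" "G \<in> holo_maps D unit_disc"
  shows "hyp_deriv G w \<le> hyp_deriv F w"
proof -
  let ?g = "Moebius_function 0 (G w) \<circ> G"
  have Gw: "cmod (G w) < 1" using assms by (auto simp: holo_maps_def)
  have g: "?g \<in> holo_maps D (cball 0 1)"
    using Moebius_comp_holo_maps[OF Gw assms(4)] by (rule holo_maps_mono[rotated]) auto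
  have 0: "?g w = 0" by (simp add: Moebius_function_eq_zero)
  have "hyp_deriv G w = hyp_deriv ?g w"
    using hyp_deriv_Moebius_comp[OF assms(1,2,4) Gw] by simp
  also have "\<dots> = cmod (deriv ?g w)" using 0 by (rule hyp_deriv_zero)
  also have "\<dots> \<le> hyp_deriv F w"
    using assms(3) g 0 unfolding carath_extremal_def by blast
  finally show ?thesis .
qed

text \<open>The supremum is a maximum, attained by \<open>F\<close> followed by the Moebius map that
  sends \<open>F w\<close> to 0.\<close>

lemma carath_reiffen_eq_hyp_deriv:
  assumes "open D" "w \<in> D" "F \<in> holo_maps D unit_disc" "carath_extremal D F w"
  shows "carath_reiffen D w X = hyp_deriv F w * cmod X"
  unfolding carath_reiffen_def
proof (rule cSup_eq_maximum)
  let ?f = "Moebius_function 0 (F w) \<circ> F"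
  have Fw: "cmod (F w) < 1" using assms by (auto simp: holo_maps_def)
  have f: "?f \<in> holo_maps D (cball 0 1)"
    using Moebius_comp_holo_maps[OF Fw assms(3)] by (rule holo_maps_mono[rotated]) auto
  have 0: "?f w = 0" by (simp add: Moebius_function_eq_zero)
  have "hyp_deriv F w = cmod (deriv ?f w)"
    using hyp_deriv_Moebius_comp[OF assms(1,2,3) Fw] hyp_deriv_zero[of ?f w, OF 0] by simp
  then show "hyp_deriv F w * cmod X \<in> (\<lambda>F. cmod (deriv F w * X)) `
      {F \<in> holo_maps D (cball 0 1). F w = 0}"
    using f 0 by (intro image_eqI[of _ _ ?f]) (simp_all add: norm_mult)
next
  fix x assume "x \<in> (\<lambda>F. cmod (deriv F w * X)) ` {F \<in> holo_maps D (cball 0 1). F w = 0}"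
  then show "x \<le> hyp_deriv F w * cmod X"
    using assms(4) unfolding carath_extremal_def by (auto simp: norm_mult intro!: mult_right_mono)
qed

text \<open>Serves twice: on a small disc in \<open>D\<close> it bounds the set defining
  \<open>carath_reiffen\<close>, and on discs with radii tending to 1 it yields the Schwarz-Pick
  inequality.\<close>

lemma Cauchy_estimate_cball:
  assumes "f \<in> holo_maps D (cball 0 1)" "open D" "0 < r" "cball w r \<subseteq> D"
  shows "cmod (deriv f w) \<le> 1 / r"
proof -
  have hol: "f holomorphic_on cball w r" and B: "\<And>z. z \<in> cball w r \<Longrightarrow> cmod (f z) \<le> 1"
    using assms by (auto simp: holo_maps_def image_subset_iff subset_iff intro: holomorphic_on_subset)
  have "norm ((deriv ^^ 1) f w) \<le> fact 1 * 1 / r ^ 1"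
  proof (rule Cauchy_inequality)
    show "f holomorphic_on ball w r"
      using hol ball_subset_cball holomorphic_on_subset by blast
    show "continuous_on (cball w r) f"
      using hol by (rule holomorphic_on_imp_continuous_on)
    show "norm (f x) \<le> 1" if "norm (w - x) = r" for x
      using that B[of x] by (simp add: dist_norm)
  qed (rule assms)
  then show ?thesis by simp
qed

lemma bdd_above_carath_reiffen:
  assumes "open D" "w \<in> D"
  shows "bdd_above ((\<lambda>F. cmod (deriv F w * X)) ` {F \<in> holo_maps D (cball 0 1). F w = 0})"
proof -
  obtain r where r: "0 < r" "cball w r \<subseteq> D"
    using assms open_contains_cball by blast
  show ?thesis
    by (rule bdd_aboveI2[where M = "1 / r * cmod X"])
       (use Cauchy_estimate_cball[OF _ assms(1) r] in
         \<open>auto simp only: norm_mult mem_Collect_eq intro!: mult_right_mono norm_ge_zero\<close>)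
qed

text \<open>The infinitesimal Schwarz-Pick lemma: composing with the automorphism that sends 0 to
  \<open>w\<close> reduces it to a derivative bound at 0.\<close>

lemma carath_extremal_id_unit_disc:
  assumes "w \<in> unit_disc"
  shows "carath_extremal unit_disc (\<lambda>z. z) w"
  unfolding carath_extremal_def
proof (intro ballI impI)
  fix f assume f: "f \<in> holo_maps unit_disc (cball 0 1)" and fw: "f w = 0"
  have w: "cmod w < 1" "cmod (- w) < 1" using assms by auto
  let ?m = "Moebius_function 0 (- w)"
  have m0: "?m 0 = w" by (simp add: Moebius_function_of_zero)
  have "?m ` unit_disc \<subseteq> unit_disc"
    using Moebius_function_norm_lt_1[OF w(2)] by auto
  then have fm: "f \<circ> ?m \<in> holo_maps unit_disc (cball 0 1)"
    using f Moebius_function_holomorphic[OF w(2)]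
    unfolding holo_maps_def by (fastforce intro: holomorphic_on_compose_gen)
  have "(f has_field_derivative deriv f w) (at w)"
    using f assms by (auto simp: holo_maps_def intro: holomorphic_derivI)
  then have "((f \<circ> ?m) has_field_derivative deriv f w * (1 - complex_of_real ((cmod w)\<^sup>2))) (at 0)"
    using DERIV_chain[of f "deriv f w" ?m 0 _ UNIV] has_field_derivative_Moebius[OF w(2), of 0] m0 by simp
  then have d: "deriv (f \<circ> ?m) 0 = deriv f w * (1 - complex_of_real ((cmod w)\<^sup>2))"
    by (rule DERIV_imp_deriv)
  have w2: "(cmod w)\<^sup>2 < 1"
    using w by (simp add: power_less_one_iff abs_square_less_1)
  have "cmod (deriv (f \<circ> ?m) 0) \<le> 1"
  \<comment> \<open>Cauchy's estimate gives the bound \<open>1 / r\<close> for each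
    \<open>r < 1\<close>; the rule lets \<open>r\<close> tend to 1.\<close>
  proof (rule field_le_mult_one_interval)
    fix r :: real assume r: "0 < r" "r < 1"
    have "cmod (deriv (f \<circ> ?m) 0) \<le> 1 / r"
      using fm r by (intro Cauchy_estimate_cball[of _ unit_disc]) auto
    then show "r * cmod (deriv (f \<circ> ?m) 0) \<le> 1"
      using r by (simp add: field_simps)
  qed
  moreover have "cmod (1 - complex_of_real ((cmod w)\<^sup>2)) = 1 - (cmod w)\<^sup>2"
    using w2 by (metis abs_of_pos diff_gt_0_iff_gt norm_of_real of_real_1 of_real_diff)
  ultimately have "cmod (deriv f w) * (1 - (cmod w)\<^sup>2) \<le> 1"
    unfolding d norm_mult of_real_diff of_real_1 by metis
  then show "cmod (deriv f w) \<le> hyp_deriv (\<lambda>z. z) w"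
    using w2 by (simp add: hyp_deriv_def field_simps)
qed

lemma carath_reiffen_unit_disc:
  assumes "w \<in> unit_disc"
  shows "carath_reiffen unit_disc w Y = cmod Y / (1 - (cmod w)\<^sup>2)"
  using carath_reiffen_eq_hyp_deriv[OF open_ball assms _ carath_extremal_id_unit_disc[OF assms]]
  by (simp add: holo_maps_def hyp_deriv_def)

text \<open>In one variable both metrics scale by \<open>cmod X\<close>, so testing
  \<open>X = 1\<close> suffices and universality becomes pointwise extremality.\<close>

lemma universal_set_inf_carath_iff:
  assumes "open D"
  shows "universal_set_inf_carath D C \<longleftrightarrow>
    C \<subseteq> holo_maps D unit_disc \<and> (\<forall>w\<in>D. \<exists>F\<in>C. carath_extremal D F w)" (is "?L \<longleftrightarrow> ?R")
proof
  assume L: ?L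
  have "\<exists>F\<in>C. carath_extremal D F w" if w: "w \<in> D" for w
  proof -
    obtain F where F: "F \<in> C" "carath_reiffen D w 1 = carath_reiffen unit_disc (F w) (deriv F w * 1)"
      using L w unfolding universal_set_inf_carath_def by (metis one_neq_zero)
    moreover have "F w \<in> unit_disc"
      using F(1) L w unfolding universal_set_inf_carath_def holo_maps_def by blast
    ultimately have eq: "carath_reiffen D w 1 = hyp_deriv F w"
      by (simp add: carath_reiffen_unit_disc hyp_deriv_def)
    have "cmod (deriv f w) \<le> carath_reiffen D w 1"
      if "f \<in> holo_maps D (cball 0 1)" "f w = 0" for f
      unfolding carath_reiffen_def
      using that by (intro cSup_upper bdd_above_carath_reiffen assms w) auto
    then show ?thesis
      using F(1) eq unfolding carath_extremal_def by auto
  qed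
  then show ?R using L unfolding universal_set_inf_carath_def by auto
next
  assume R: ?R
  have "\<exists>F\<in>C. carath_reiffen D w X = carath_reiffen unit_disc (F w) (deriv F w * X)"
    if w: "w \<in> D" for w X
  proof -
    obtain F where F: "F \<in> C" "carath_extremal D F w" using R w by blast
    then have FD: "F \<in> holo_maps D unit_disc" using R by blast
    then have "F w \<in> unit_disc" using w by (auto simp: holo_maps_def)
    then show ?thesis
      using F(1) carath_reiffen_eq_hyp_deriv[OF assms w FD F(2), of X]
      by (intro bexI[of _ F]) (simp_all add: carath_reiffen_unit_disc hyp_deriv_def norm_mult)
  qed
  then show ?L using R unfolding universal_set_inf_carath_def by blast
qed

section \<open>Uniqueness of extremal functions\<close>

text \<open>Dividing \<open>q\<close> by \<open>(z - w) ^ (n - 1)\<close>, with \<open>n\<close> the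
  order of its zero, leaves a simple zero. Off the ball of radius \<open>s\<close> the divisor has
  modulus at least \<open>s ^ (n - 1)\<close>, which is the constant \<open>c\<close>.\<close>

lemma holomorphic_lower_zero_order:
  assumes "q holomorphic_on D" "open D" "connected D" "w \<in> D" "q w = 0" "\<not> q constant_on D"
  obtains h s c where "h holomorphic_on D" "h w = 0" "deriv h w \<noteq> 0"
    "0 < s" "cball w s \<subseteq> D" "0 < c" "\<And>z. z \<in> D \<Longrightarrow> z \<notin> ball w s \<Longrightarrow> c * cmod (h z) \<le> cmod (q z)"
proof -
  obtain g r n where n: "0 < n" and r: "0 < r" "ball w r \<subseteq> D" and g: "g holomorphic_on ball w r"
    and qg: "\<And>z. z \<in> ball w r \<Longrightarrow> q z = (z - w) ^ n * g z" and gnz: "\<And>z. z \<in> ball w r \<Longrightarrow> g z \<noteq> 0"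
    by (rule holomorphic_factor_zero_nonconstant[OF assms]) blast
  \<comment> \<open>The two formulas agree on the punctured ball; the first is holomorphic at
    \<open>w\<close>, the second on all of \<open>D - {w}\<close>.\<close>
  define h where "h z = (if z \<in> ball w r then (z - w) * g z else q z / (z - w) ^ (n - 1))" for z
  have "h holomorphic_on ball w r \<union> (D - {w})"
    unfolding h_def
  proof (rule holomorphic_on_If_Un)
    show "(\<lambda>z. (z - w) * g z) holomorphic_on ball w r"
      using g by (intro holomorphic_intros)
    show "(\<lambda>z. q z / (z - w) ^ (n - 1)) holomorphic_on D - {w}"
      using assms(1) by (auto intro!: holomorphic_intros elim: holomorphic_on_subset)
    show "(z - w) * g z = q z / (z - w) ^ (n - 1)" if "z \<in> ball w r" "z \<in> D - {w}" for z
      using that n qg[OF that(1)] by (cases n) auto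
  qed (use assms in auto)
  moreover have "ball w r \<union> (D - {w}) = D" using r assms(4) by auto
  ultimately have hD: "h holomorphic_on D" by simp
  have "((\<lambda>z. (z - w) * g z) has_field_derivative g w) (at w)"
    using g r by (auto intro!: derivative_eq_intros holomorphic_derivI[OF g])
  then have "(h has_field_derivative g w) (at w)"
    by (rule has_field_derivative_transform_within_open[of _ _ _ "ball w r"]) (use r in \<open>auto simp: h_def\<close>)
  then have "deriv h w = g w" by (rule DERIV_imp_deriv)
  then have "deriv h w \<noteq> 0" using gnz r by simp
  moreover have "h w = 0" using r by (simp add: h_def)
  moreover have "cball w (r / 2) \<subseteq> D"
    using r by (auto simp: subset_iff)
  moreover have "(r / 2) ^ (n - 1) * cmod (h z) \<le> cmod (q z)" if z: "z \<in> D" "z \<notin> ball w (r / 2)" for z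
  proof -
    have "z \<noteq> w" using z r by auto
    then have "q z = (z - w) ^ (n - 1) * h z"
      using n qg[of z] by (cases n) (auto simp: h_def)
    moreover have "(r / 2) ^ (n - 1) \<le> cmod (z - w) ^ (n - 1)"
      using z r by (intro power_mono) (auto simp: dist_norm norm_minus_commute)
    ultimately show ?thesis
      by (simp add: norm_mult norm_power mult_right_mono)
  qed
  moreover have "0 < r / 2" "0 < (r / 2) ^ (n - 1)" using r by simp_all
  ultimately show thesis using that[OF hD] by blast
qed

text \<open>Turning \<open>b\<close> into the direction of \<open>a\<close> gives equality in the
  triangle inequality, so a perturbation adds the full modulus of its derivative.\<close>

lemma exists_rotation_norm_add:
  obtains u :: complex where "cmod u = 1" "cmod (a + u * b) = cmod a + cmod b"
proof (cases "b = 0 \<or> a = 0")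
  case True
  then show ?thesis using that[of 1] by auto
next
  case False
  define u where "u = (a / cmod a) * (cmod b / b)"
  have "a + u * b = (a / cmod a) * (cmod a + cmod b)"
    using False by (simp add: u_def field_simps)
  then have "cmod (a + u * b) = cmod (a / cmod a) * cmod (complex_of_real (cmod a + cmod b))"
    by (simp only: norm_mult of_real_add)
  also have "\<dots> = cmod a + cmod b"
    using False by (simp only: norm_of_real norm_divide) (simp add: norm_divide)
  finally have "cmod (a + u * b) = cmod a + cmod b" .
  moreover have "cmod u = 1" using False by (simp add: u_def norm_mult norm_divide)
  ultimately show ?thesis using that by blast
qed

text \<open>
  If \<open>q\<close> has order \<open>n\<close> at \<open>w\<close>, then \<open>q / (z - w)^(n - 1)\<close> has a simple zero there. A small rotated
  multiple of it is dominated by \<open>q\<close> away from \<open>w\<close>, so adding it to \<open>f\<close> keeps the modulus at most 1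
  (near \<open>w\<close> by the maximum principle) but increases the derivative at \<open>w\<close>.
\<close>

lemma extremal_perturbation_trivial:
  assumes D: "open D" "connected D" and w: "w \<in> D"
    and f: "f holomorphic_on D" "f w = 0" and q: "q holomorphic_on D" "q w = 0"
    and bound: "\<And>z. z \<in> D \<Longrightarrow> cmod (f z) + cmod (q z) \<le> 1"
    and ext: "\<And>g. g \<in> holo_maps D (cball 0 1) \<Longrightarrow> g w = 0 \<Longrightarrow> cmod (deriv g w) \<le> cmod (deriv f w)"
    and z: "z \<in> D"
  shows "q z = 0"
proof (rule ccontr)
  assume "q z \<noteq> 0"
  then have "\<not> q constant_on D"
    using z w q(2) unfolding constant_on_def by metis
  then obtain h s c where h: "h holomorphic_on D" "h w = 0" "deriv h w \<noteq> 0"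
    and s: "0 < s" "cball w s \<subseteq> D" and c: "0 < c"
    and hq: "\<And>z. z \<in> D \<Longrightarrow> z \<notin> ball w s \<Longrightarrow> c * cmod (h z) \<le> cmod (q z)"
    by (rule holomorphic_lower_zero_order[OF q(1) D w q(2)]) blast
  obtain u where u: "cmod u = 1" "cmod (deriv f w + u * (c * deriv h w)) = cmod (deriv f w) + cmod (c * deriv h w)"
    by (rule exists_rotation_norm_add)
  define G where "G z = f z + u * (c * h z)" for z
  have G: "G holomorphic_on D"
    unfolding G_def using f h by (intro holomorphic_intros)
  have out: "cmod (G z) \<le> 1" if "z \<in> D" "z \<notin> ball w s" for z
  proof -
    have "cmod (G z) \<le> cmod (f z) + c * cmod (h z)"
      unfolding G_def using norm_triangle_ineq[of "f z" "u * (c * h z)"] u(1) c by (simp add: norm_mult)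
    then show ?thesis using hq[OF that] bound[OF that(1)] by linarith
  qed
  have "cmod (G z) \<le> 1" if "z \<in> D" for z
  proof (cases "z \<in> ball w s")
    case True
    show ?thesis
    proof (rule maximum_modulus_frontier[of G "ball w s"])
      show "G holomorphic_on interior (ball w s)"
        using G s by (auto intro!: holomorphic_on_subset[OF G])
      show "continuous_on (closure (ball w s)) G"
        using s holomorphic_on_imp_continuous_on[OF G] by (auto elim: continuous_on_subset)
      \<comment> \<open>Frontier points lie in \<open>cball w s\<close>, hence in \<open>D\<close>,
        but not in the open ball, so the outer estimate applies to them.\<close>
      show "cmod (G z) \<le> 1" if "z \<in> frontier (ball w s)" for z
        using that s by (intro out) (auto simp: subset_iff)
    qed (use True in auto)
  qed (use out that in auto)
  then have "G \<in> holo_maps D (cball 0 1)" "G w = 0"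
    using G f h by (auto simp: holo_maps_def G_def)
  then have le: "cmod (deriv G w) \<le> cmod (deriv f w)" by (rule ext)
  have "deriv G w = deriv f w + u * (c * deriv h w)"
    unfolding G_def by (rule DERIV_imp_deriv) (use f h D w in \<open>auto intro!: derivative_eq_intros holomorphic_derivI\<close>)
  then have "cmod (deriv G w) = cmod (deriv f w) + c * cmod (deriv h w)"
    using u c by (simp add: norm_mult)
  moreover have "0 < c * cmod (deriv h w)" using c h(3) by simp
  ultimately show False using le by linarith
qed

text \<open>The midpoint of two extremal functions with the same derivative at \<open>w\<close> is
  extremal, yet it leaves room for a perturbation built from the square of their difference. That
  perturbation must vanish.\<close>

lemma extremal_unique:
  assumes D: "open D" "connected D" and w: "w \<in> D"
    and f: "f \<in> holo_maps D (cball 0 1)" "f w = 0" and g: "g \<in> holo_maps D (cball 0 1)" "g w = 0"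
    and eq: "deriv f w = deriv g w"
    and ext: "\<And>k. k \<in> holo_maps D (cball 0 1) \<Longrightarrow> k w = 0 \<Longrightarrow> cmod (deriv k w) \<le> cmod (deriv f w)"
    and z: "z \<in> D"
  shows "f z = g z"
proof -
  have hol: "f holomorphic_on D" "g holomorphic_on D"
    and le: "\<And>z. z \<in> D \<Longrightarrow> cmod (f z) \<le> 1" "\<And>z. z \<in> D \<Longrightarrow> cmod (g z) \<le> 1"
    using f g by (auto simp: holo_maps_def)
  \<comment> \<open>The parallelogram law gives \<open>|p|\<^sup>2 + 2|q| \<le> 1\<close>, hence \<open>|p| + |q| \<le> 1\<close>, while \<open>p'(w) = f'(w)\<close>.\<close>
  define p where "p z = (f z + g z) / 2" for z
  define q where "q z = ((f z - g z) / 2)\<^sup>2 / 2" for z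
  have "deriv p w = deriv f w"
    unfolding p_def by (rule DERIV_imp_deriv)
      (use hol D w eq in \<open>auto intro!: derivative_eq_intros holomorphic_derivI\<close>)
  moreover have "cmod (p z) + cmod (q z) \<le> 1" if "z \<in> D" for z
  proof -
    have "(cmod ((f z + g z) / 2))\<^sup>2 + (cmod ((f z - g z) / 2))\<^sup>2 = ((cmod (f z))\<^sup>2 + (cmod (g z))\<^sup>2) / 2"
      unfolding cmod_power2 by (simp add: power2_eq_square field_simps)
    moreover have "(cmod (f z))\<^sup>2 \<le> 1" "(cmod (g z))\<^sup>2 \<le> 1"
      using le[OF that] by (simp_all add: abs_square_le_1)
    ultimately have "(cmod (p z))\<^sup>2 + 2 * cmod (q z) \<le> 1"
      by (simp add: p_def q_def norm_power norm_divide)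
    moreover have "2 * cmod (p z) \<le> 1 + (cmod (p z))\<^sup>2"
      using sum_squares_bound[of 1 "cmod (p z)"] by simp
    ultimately show ?thesis by linarith
  qed
  moreover have "p holomorphic_on D" "q holomorphic_on D" "p w = 0" "q w = 0"
    using hol f(2) g(2) unfolding p_def q_def by (auto intro!: holomorphic_intros)
  ultimately have "q z = 0"
    using ext by (intro extremal_perturbation_trivial[OF D w, of p q z] z) simp_all
  then show ?thesis by (simp add: q_def)
qed

section \<open>From a finite universal set to a single function\<close>

text \<open>Normalised to vanish at \<open>w\<close>, the two functions have derivatives of equal
  modulus there. Rotating one by \<open>u\<close> makes the derivatives equal, so uniqueness makes
  the functions equal on \<open>D\<close>; Moebius maps and rotations preserve
  \<open>hyp_deriv\<close>.\<close>

lemma hyp_deriv_eq_of_common_extremal: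
  assumes D: "open D" "connected D" and w: "w \<in> D"
    and F: "F \<in> holo_maps D unit_disc" "carath_extremal D F w"
    and G: "G \<in> holo_maps D unit_disc" "carath_extremal D G w"
    and z: "z \<in> D"
  shows "hyp_deriv F z = hyp_deriv G z"
proof -
  define f where "f = Moebius_function 0 (F w) \<circ> F"
  define g where "g = Moebius_function 0 (G w) \<circ> G"
  have Fw: "cmod (F w) < 1" and Gw: "cmod (G w) < 1"
    using F G w by (auto simp: holo_maps_def)
  have f: "f \<in> holo_maps D unit_disc" and g: "g \<in> holo_maps D unit_disc"
    unfolding f_def g_def using Moebius_comp_holo_maps Fw Gw F G by auto
  have f0: "f w = 0" and g0: "g w = 0"
    by (simp_all add: f_def g_def Moebius_function_eq_zero)
  have hf: "hyp_deriv f y = hyp_deriv F y" and hg: "hyp_deriv g y = hyp_deriv G y" if "y \<in> D" for y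
    unfolding f_def g_def using hyp_deriv_Moebius_comp[OF D(1) that] F G Fw Gw by auto
  have df: "hyp_deriv F w = cmod (deriv f w)" and dg: "hyp_deriv G w = cmod (deriv g w)"
    using hf[OF w] hg[OF w] hyp_deriv_zero f0 g0 by metis+
  have "cmod (deriv f w) = cmod (deriv g w)"
    using carath_extremal_hyp_deriv_le[OF D(1) w] F G df dg by (metis order_antisym)
  then have "\<exists>u. cmod u = 1 \<and> deriv f w = u * deriv g w"
    by (cases "deriv g w = 0") (auto intro: exI[of _ 1] exI[of _ "deriv f w / deriv g w"] simp: norm_divide)
  then obtain u where u: "cmod u = 1" "deriv f w = u * deriv g w" by blast
  define k where "k = (\<lambda>z. u * g z)"
  have gD: "g holomorphic_on D" "\<And>z. z \<in> D \<Longrightarrow> cmod (g z) < 1"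
    using g by (auto simp: holo_maps_def)
  have dk: "deriv k y = u * deriv g y" if "y \<in> D" for y
    unfolding k_def using holomorphic_on_imp_differentiable_at[OF gD(1) D(1) that]
    by (rule deriv_cmult)
  have k: "k \<in> holo_maps D unit_disc"
    using gD u unfolding holo_maps_def k_def by (auto intro!: holomorphic_intros simp: norm_mult)
  have cb: "h \<in> holo_maps D (cball 0 1)" if "h \<in> holo_maps D unit_disc" for h
    using that by (rule holo_maps_mono[rotated]) auto
  have "f y = k y" if "y \<in> D" for y
  proof (rule extremal_unique[OF D w, of f k])
    show "cmod (deriv h w) \<le> cmod (deriv f w)" if "h \<in> holo_maps D (cball 0 1)" "h w = 0" for h
      using F(2) that df unfolding carath_extremal_def by metis
  qed (use cb f k f0 g0 u dk[OF w] that in \<open>auto simp: k_def\<close>)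
  then have fk: "f z = k z" and ev: "eventually (\<lambda>y. f y = k y) (nhds z)"
    using D(1) z by (auto simp: eventually_nhds)
  from ev have "deriv f z = deriv k z" by (rule deriv_cong_ev) simp
  with fk have "hyp_deriv f z = hyp_deriv g z"
    using u dk[OF z] by (simp add: hyp_deriv_def k_def norm_mult)
  then show ?thesis using hf hg z by simp
qed

lemma finite_universal_imp_single_universal:
  assumes D: "open D" "connected D" "D \<noteq> {}"
    and C: "finite C" "universal_set_inf_carath D C"
  obtains F where "F \<in> holo_maps D unit_disc" "universal_set_inf_carath D {F}"
proof -
  have CD: "C \<subseteq> holo_maps D unit_disc" and ex: "\<And>w. w \<in> D \<Longrightarrow> \<exists>F\<in>C. carath_extremal D F w"
    using C(2) universal_set_inf_carath_iff[OF D(1)] by auto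
  \<comment> \<open>Two of these sets that meet coincide, so they form a finite closed partition of \<open>D\<close>.\<close>
  define A where "A F = {w \<in> D. carath_extremal D F w}" for F
  \<comment> \<open>Some member of \<open>C\<close> is extremal at each point, so comparison with
    \<open>C\<close> alone decides extremality. This describes \<open>A F\<close> by inequalities
    between continuous functions, which makes it closed.\<close>
  have A_eq: "A F = {w \<in> D. \<forall>G\<in>C. hyp_deriv G w \<le> hyp_deriv F w}" if "F \<in> C" for F
  proof (intro Collect_cong conj_cong refl iffI ballI A_def[THEN trans])
    fix w assume "w \<in> D" "\<forall>G\<in>C. hyp_deriv G w \<le> hyp_deriv F w"
    then show "carath_extremal D F w"
      using ex[of w] unfolding carath_extremal_def by (meson order_trans)
  next
    fix w G assume "w \<in> D" "carath_extremal D F w" "G \<in> C"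
    then show "hyp_deriv G w \<le> hyp_deriv F w"
      using carath_extremal_hyp_deriv_le[OF D(1)] CD by blast
  qed
  have closed: "closedin (top_of_set D) (A F)" if F: "F \<in> C" for F
  proof -
    have "closedin (top_of_set D) (D \<inter> (\<lambda>w. hyp_deriv F w - hyp_deriv G w) -` {0..})" if "G \<in> C" for G
      by (rule continuous_closedin_preimage, intro continuous_intros continuous_on_hyp_deriv D)
        (use that F CD in auto)
    then have "closedin (top_of_set D) (\<Inter>G\<in>C. D \<inter> (\<lambda>w. hyp_deriv F w - hyp_deriv G w) -` {0..})"
      using F by (intro closedin_Inter) auto
    moreover have "(\<Inter>G\<in>C. D \<inter> (\<lambda>w. hyp_deriv F w - hyp_deriv G w) -` {0..}) = A F"
      unfolding A_eq[OF F] using F by auto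
    ultimately show ?thesis by simp
  qed
  obtain w0 F where w0: "w0 \<in> D" and F: "F \<in> C" "carath_extremal D F w0"
    using D(3) ex by blast
  have sub: "A G \<subseteq> A F" if G: "G \<in> C" "A G \<inter> A F \<noteq> {}" for G
  proof -
    obtain v where v: "v \<in> D" "carath_extremal D G v" "carath_extremal D F v"
      using G by (auto simp: A_def)
    have "hyp_deriv G z = hyp_deriv F z" if "z \<in> D" for z
      using hyp_deriv_eq_of_common_extremal[OF D(1,2) v(1) _ v(2) _ v(3) that] G F CD by blast
    then show ?thesis by (auto simp: A_def carath_extremal_def)
  qed
  \<comment> \<open>By \<open>sub\<close>, a locus that meets \<open>A F\<close> contributes nothing
    to the complement. The remaining ones are finitely many closed sets, so \<open>A F\<close> is
    also open.\<close>
  have "D - A F = (\<Union>G\<in>{G \<in> C. A G \<inter> A F = {}}. A G)"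
  proof
    show "D - A F \<subseteq> (\<Union>G\<in>{G \<in> C. A G \<inter> A F = {}}. A G)"
    proof
      fix w assume w: "w \<in> D - A F"
      then obtain G where "G \<in> C" "w \<in> A G" using ex by (auto simp: A_def)
      then show "w \<in> (\<Union>G\<in>{G \<in> C. A G \<inter> A F = {}}. A G)" using sub[of G] w by auto
    qed
  qed (auto simp: A_def)
  also have "closedin (top_of_set D) \<dots>"
    using C(1) closed by (intro closedin_Union) auto
  finally have "openin (top_of_set D) (A F)"
    using closed[OF F(1)] by (simp add: openin_closedin_eq A_def)
  then have "A F = D"
    using D(2) closed[OF F(1)] w0 F(2) unfolding connected_clopen A_def by blast
  then have "universal_set_inf_carath D {F}"
    using F CD unfolding universal_set_inf_carath_iff[OF D(1)] A_def by blast
  then show thesis using that F CD by blast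
qed

section \<open>Non-degeneracy of the metric on c-finitely compact domains\<close>

text \<open>If the metric degenerates at \<open>w\<close>, the zero function is extremal there, and
  the difference of \<open>H\<close> and \<open>H w\<close>, halved to keep its modulus at most 1,
  is an admissible perturbation of it.\<close>

lemma extremal_zero_imp_constant:
  assumes D: "open D" "connected D" and w: "w \<in> D" "carath_extremal D F w" "hyp_deriv F w = 0"
    and H: "H \<in> holo_maps D unit_disc" and z: "z \<in> D"
  shows "H z = H w"
proof -
  have hol: "H holomorphic_on D" and le: "\<And>z. z \<in> D \<Longrightarrow> cmod (H z) \<le> 1"
    using H by (fastforce simp: holo_maps_def)+
  have "(H z - H w) / 2 = 0"
  proof (rule extremal_perturbation_trivial[OF D w(1), of "\<lambda>_. 0" "\<lambda>z. (H z - H w) / 2"])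
    show "cmod 0 + cmod ((H y - H w) / 2) \<le> 1" if "y \<in> D" for y
      using norm_triangle_ineq4[of "H y" "H w"] le[OF that] le[OF w(1)] by (simp add: norm_divide)
    show "cmod (deriv g w) \<le> cmod (deriv (\<lambda>_. 0) w)"
      if "g \<in> holo_maps D (cball 0 1)" "g w = 0" for g
      using that w unfolding carath_extremal_def by force
  qed (use hol z in \<open>auto intro!: holomorphic_intros\<close>)
  then show ?thesis by simp
qed

text \<open>Degeneracy at one point makes every map to the disc constant, so a Caratheodory ball is
  all of \<open>D\<close>. Then \<open>D\<close> is compact and open, hence the whole plane, which
  is not compact.\<close>

lemma c_finitely_compact_imp_hyp_deriv_nonzero:
  assumes D: "open D" "connected D" and fin: "c_finitely_compact D"
    and w: "w \<in> D" "carath_extremal D F w"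
  shows "hyp_deriv F w \<noteq> 0"
proof
  assume 0: "hyp_deriv F w = 0"
  have "carath_dist D w z \<le> 0" if "z \<in> D" for z
    unfolding carath_dist_def
  proof (rule cSUP_least)
    have "(\<lambda>_. 0) \<in> holo_maps D unit_disc" by (auto simp: holo_maps_def)
    then show "holo_maps D unit_disc \<noteq> {}" by blast
    show "hyp_dist (H w) (H z) \<le> 0" if "H \<in> holo_maps D unit_disc" for H
      using extremal_zero_imp_constant[OF D w 0 that \<open>z \<in> D\<close>] by (simp add: hyp_dist_def)
  qed
  then have eq: "{z \<in> D. carath_dist D w z < 1} = D" by force
  have "relatively_compact_in {z \<in> D. carath_dist D w z < 1} D"
    using fin w(1) unfolding c_finitely_compact_def by (metis zero_less_one)
  then have K: "compact (closure D)" "closure D \<subseteq> D"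
    unfolding eq relatively_compact_in_def by auto
  then have "closed D" by (metis closure_subset closed_closure subset_antisym)
  then have "D = UNIV" using D(1) w(1) by (metis clopen empty_iff)
  then show False using K by (auto simp: not_compact_UNIV)
qed

section \<open>Caratheodory distance along sections\<close>

lemma artanh_mono:
  fixes x y :: real
  assumes "0 \<le> x" "x \<le> y" "y < 1"
  shows "artanh x \<le> artanh y"
proof -
  have "(1 + x) / (1 - x) \<le> (1 + y) / (1 - y)"
    using assms by (intro frac_le) auto
  moreover have "0 < (1 + x) / (1 - x)"
    using assms by (intro divide_pos_pos) auto
  ultimately show ?thesis
    unfolding artanh_def by (simp add: ln_mono)
qed

text \<open>The metric inequality is integrated along the segment from 0 to \<open>z\<close>, by
  comparing derivatives instead of using path integrals.\<close>

lemma artanh_norm_le_of_hyp_deriv_le: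
  assumes k: "k holomorphic_on ball 0 r" "k 0 = 0" and r: "r \<le> 1"
    and lt: "\<And>z. z \<in> ball 0 r \<Longrightarrow> cmod (k z) < 1"
    and hd: "\<And>z. z \<in> ball 0 r \<Longrightarrow> hyp_deriv k z \<le> 1 / (1 - (cmod z)\<^sup>2)"
    and z: "z \<in> ball 0 r"
  shows "artanh (cmod (k z)) \<le> artanh (cmod z)"
proof -
  obtain a where a: "cmod a = 1" "complex_of_real (cmod z) * a = z"
  proof (cases "z = 0")
    case False
    then show ?thesis using that[of "z / cmod z"] by (simp add: norm_divide)
  qed (use that[of 1] in auto)
  obtain u where u: "cmod u = 1" "u * k z = complex_of_real (cmod (k z))"
  proof (cases "k z = 0")
    case False
    then show ?thesis using that[of "cmod (k z) / k z"] by (simp add: norm_divide)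
  qed (use that[of 1] in auto)
  \<comment> \<open>The real part avoids differentiating a modulus. The rotation \<open>u\<close>
    makes it equal to \<open>cmod (k z)\<close> at the endpoint, and elsewhere it is bounded by the
    modulus of \<open>k\<close>, so its hyperbolic speed is at most
    \<open>hyp_deriv k\<close>.\<close>
  define p where "p t = Re (u * k (complex_of_real t * a))" for t
  have "artanh (p 0) - artanh 0 \<ge> artanh (p (cmod z)) - artanh (cmod z)"
  proof (rule DERIV_nonpos_imp_nonincreasing[of 0 "cmod z" "\<lambda>t. artanh (p t) - artanh t"])
    fix t assume t: "0 \<le> t" "t \<le> cmod z"
    let ?x = "complex_of_real t * a"
    have nx: "cmod ?x = t" using a t by (simp add: norm_mult)
    then have x: "?x \<in> ball 0 r" using t z by simp
    have t1: "t < 1" using t z r by simp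
    define p' where "p' = Re (u * (a * deriv k ?x))"
    have "((\<lambda>t. complex_of_real t * a) has_vector_derivative a) (at t)"
      by (auto intro!: derivative_eq_intros)
    then have "(k \<circ> (\<lambda>t. complex_of_real t * a) has_vector_derivative a * deriv k ?x) (at t)"
      by (rule field_vector_diff_chain_at) (use holomorphic_derivI[OF k(1) open_ball x] in simp)
    then have "((\<lambda>t. u * k (complex_of_real t * a)) has_vector_derivative u * (a * deriv k ?x)) (at t)"
      by (auto simp: o_def intro!: has_vector_derivative_mult_right)
    then have dp: "(p has_real_derivative p') (at t)"
      unfolding p_def[abs_def] p'_def has_real_derivative_iff_has_vector_derivative
      by (rule bounded_linear.has_vector_derivative[OF bounded_linear_Re])
    have "\<bar>p t\<bar> \<le> cmod (u * k ?x)" unfolding p_def by (rule abs_Re_le_cmod)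
    then have pk: "\<bar>p t\<bar> \<le> cmod (k ?x)" using u by (simp add: norm_mult)
    have pk': "p' \<le> cmod (deriv k ?x)"
      using complex_Re_le_cmod[of "u * (a * deriv k ?x)"] u a by (simp add: norm_mult p'_def)
    have k2: "(cmod (k ?x))\<^sup>2 < 1"
      using lt[OF x] by (simp add: power_less_one_iff abs_square_less_1)
    have "(p t)\<^sup>2 \<le> (cmod (k ?x))\<^sup>2"
      using pk by (metis abs_ge_zero power2_abs power_mono)
    then have "p' / (1 - (p t)\<^sup>2) \<le> hyp_deriv k ?x"
      unfolding hyp_deriv_def using pk' k2 by (intro frac_le) auto
    also have "\<dots> \<le> 1 / (1 - t\<^sup>2)" using hd[OF x] nx by simp
    finally have "p' / (1 - (p t)\<^sup>2) - 1 / (1 - t\<^sup>2) \<le> 0" by simp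
    moreover have "\<bar>p t\<bar> < 1" using pk lt[OF x] by linarith
    then have "((\<lambda>t. artanh (p t)) has_real_derivative 1 / (1 - (p t)\<^sup>2) * p') (at t)"
      by (intro DERIV_chain2[OF artanh_real_has_field_derivative dp])
    then have "((\<lambda>t. artanh (p t) - artanh t) has_real_derivative
        1 / (1 - (p t)\<^sup>2) * p' - 1 / (1 - t\<^sup>2)) (at t)"
      using t t1 by (intro DERIV_diff artanh_real_has_field_derivative) auto
    ultimately show "\<exists>y. ((\<lambda>t. artanh (p t) - artanh t) has_real_derivative y) (at t) \<and> y \<le> 0"
      by (metis mult.left_neutral times_divide_eq_left)
  qed simp
  moreover have "p 0 = 0" using k by (simp add: p_def)
  moreover have "p (cmod z) = cmod (k z)" using a u by (simp add: p_def)
  ultimately show ?thesis by simp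
qed

lemma hyp_deriv_comp:
  assumes "F field_differentiable at (g z)" "g field_differentiable at z"
  shows "hyp_deriv (F \<circ> g) z = hyp_deriv F (g z) * cmod (deriv g z)"
  using deriv_chain[OF assms(2,1)] by (simp add: hyp_deriv_def norm_mult)

text \<open>Fixing the value at 0 makes sections agree on common discs when
  \<open>deriv F w0\<close> is nonzero (\<open>local_section_unique\<close>), so they can be
  glued.\<close>

definition local_section ::
    "complex set \<Rightarrow> (complex \<Rightarrow> complex) \<Rightarrow> complex \<Rightarrow> real \<Rightarrow> (complex \<Rightarrow> complex) \<Rightarrow> bool" where
  "local_section D F w0 r g \<longleftrightarrow>
     g holomorphic_on ball 0 r \<and> g ` ball 0 r \<subseteq> D \<and> g 0 = w0 \<and> (\<forall>z\<in>ball 0 r. F (g z) = z)"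

text \<open>Extremality bounds \<open>hyp_deriv\<close> of any competitor by that of
  \<open>F\<close>, and \<open>F\<close> composed with \<open>g\<close> is the identity. Each
  competitor composed with \<open>g\<close> thus satisfies the Schwarz-Pick bound, which is then
  integrated.\<close>

lemma carath_dist_local_section_le:
  assumes D: "open D" and F: "F \<in> holo_maps D unit_disc" "\<And>w. w \<in> D \<Longrightarrow> carath_extremal D F w"
    and g: "local_section D F w0 r g" and r: "r \<le> 1" and z: "z \<in> ball 0 r"
  shows "carath_dist D w0 (g z) \<le> artanh (cmod z)"
  unfolding carath_dist_def
proof (rule cSUP_least)
  have "(\<lambda>_. 0) \<in> holo_maps D unit_disc" by (auto simp: holo_maps_def)
  then show "holo_maps D unit_disc \<noteq> {}" by blast
next
  fix H assume H: "H \<in> holo_maps D unit_disc"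
  have gh: "g holomorphic_on ball 0 r" and gD: "\<And>x. x \<in> ball 0 r \<Longrightarrow> g x \<in> D" and g0: "g 0 = w0"
    and Fg: "\<And>x. x \<in> ball 0 r \<Longrightarrow> F (g x) = x"
    using g by (auto simp: local_section_def)
  have w0: "w0 \<in> D" using gD[of 0] g0 z by (auto simp: intro: le_less_trans[OF norm_ge_zero])
  have Hw: "cmod (H w0) < 1" using H w0 by (auto simp: holo_maps_def)
  define m where "m = Moebius_function 0 (H w0) \<circ> H"
  have m: "m \<in> holo_maps D unit_disc"
    unfolding m_def using Moebius_comp_holo_maps[OF Hw H] .
  have "artanh (cmod ((m \<circ> g) z)) \<le> artanh (cmod z)"
  proof (rule artanh_norm_le_of_hyp_deriv_le[OF _ _ r _ _ z])
    show "m \<circ> g holomorphic_on ball 0 r"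
      using gh gD m by (auto simp: holo_maps_def intro: holomorphic_on_compose_gen)
    show "(m \<circ> g) 0 = 0" by (simp add: m_def g0 Moebius_function_eq_zero)
    fix x :: complex assume x: "x \<in> ball 0 r"
    show "cmod ((m \<circ> g) x) < 1"
      using gD[OF x] m by (auto simp: holo_maps_def)
    have dg: "g field_differentiable at x"
      using holomorphic_on_imp_differentiable_at[OF gh open_ball x] .
    have dd: "f field_differentiable at (g x)" if "f \<in> holo_maps D E" for f E
      using that gD[OF x] D by (auto simp: holo_maps_def intro: holomorphic_on_imp_differentiable_at)
    have "hyp_deriv (m \<circ> g) x = hyp_deriv m (g x) * cmod (deriv g x)"
      using hyp_deriv_comp[OF dd[OF m] dg] .
    also have "\<dots> \<le> hyp_deriv F (g x) * cmod (deriv g x)"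
      using carath_extremal_hyp_deriv_le[OF D gD[OF x] F(2) m] gD[OF x]
      by (intro mult_right_mono) auto
    also have "\<dots> = hyp_deriv (F \<circ> g) x"
      using hyp_deriv_comp[OF dd[OF F(1)] dg] by simp
    also have "\<dots> = 1 / (1 - (cmod x)\<^sup>2)"
    proof -
      have "eventually (\<lambda>y. y \<in> ball 0 r) (nhds x)"
        using x by (intro eventually_nhds_in_open) auto
      then have "eventually (\<lambda>y. (F \<circ> g) y = y) (nhds x)"
        by (rule eventually_mono) (simp add: Fg)
      then have "deriv (F \<circ> g) x = deriv (\<lambda>y. y) x"
        by (rule deriv_cong_ev) simp
      then show ?thesis using Fg[OF x] by (simp add: hyp_deriv_def)
    qed
    finally show "hyp_deriv (m \<circ> g) x \<le> 1 / (1 - (cmod x)\<^sup>2)" .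
  qed
  \<comment> \<open>\<open>hyp_dist\<close> conjugates its second argument, the Moebius map the
    value at \<open>w0\<close>; conjugating the denominator exchanges the two.\<close>
  moreover have "hyp_dist (H w0) (H (g z)) = artanh (cmod ((m \<circ> g) z))"
  proof -
    have "cmod (1 - cnj (H (g z)) * H w0) = cmod (cnj (1 - cnj (H (g z)) * H w0))"
      by (simp only: complex_mod_cnj)
    also have "\<dots> = cmod (1 - cnj (H w0) * H (g z))" by (simp add: mult.commute)
    finally show ?thesis
      by (simp add: hyp_dist_def m_def Moebius_function_simple norm_divide norm_minus_commute)
  qed
  ultimately show "hyp_dist (H w0) (H (g z)) \<le> artanh (cmod z)" by simp
qed

section \<open>Extension and uniqueness of local sections\<close>

text \<open>The pairs that do not violate injectivity contain a neighbourhood of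
  \<open>L \<times> L\<close>: on the diagonal by local injectivity, off it by separating the values
  of \<open>F\<close>. Compactness makes its size uniform.\<close>

lemma inj_on_neighbourhood_of_compact:
  assumes F: "F holomorphic_on D" "open D" "\<And>z. z \<in> L \<Longrightarrow> deriv F z \<noteq> 0"
    and L: "compact L" "L \<subseteq> D" "inj_on F L"
  obtains N where "open N" "L \<subseteq> N" "N \<subseteq> D" "inj_on F N"
proof -
  define G where "G = {(p, q). p \<in> D \<and> q \<in> D \<and> (F p = F q \<longrightarrow> p = q)}"
  have cont: "continuous_on D F" using F(1) by (rule holomorphic_on_imp_continuous_on)
  have "L \<times> L \<subseteq> interior G"
  proof clarify
    fix x y assume xy: "x \<in> L" "y \<in> L"
    show "(x, y) \<in> interior G"
    proof (cases "x = y")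
      case True
      obtain e where "e > 0" "ball x e \<subseteq> D" "inj_on F (ball x e)"
        using has_complex_derivative_locally_injective[OF F(1) _ F(2) F(3)] xy L(2) by blast
      then show ?thesis
        using True by (intro interiorI[of "ball x e \<times> ball x e"]) (auto simp: G_def open_Times inj_on_def)
    next
      case False
      then have "F x \<noteq> F y" using xy L(3) by (auto dest: inj_onD)
      then obtain U V where UV: "open U" "open V" "F x \<in> U" "F y \<in> V" "U \<inter> V = {}"
        using hausdorff[of "F x" "F y"] by auto
      have "open (D \<inter> F -` U)" "open (D \<inter> F -` V)"
        using continuous_open_preimage[OF cont F(2)] UV by auto
      then show ?thesis
        using UV xy L(2)
        by (intro interiorI[of "(D \<inter> F -` U) \<times> (D \<inter> F -` V)"]) (auto simp: G_def intro: open_Times)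
    qed
  qed
  then obtain e where e: "e > 0" "(\<Union>x\<in>L \<times> L. ball x e) \<subseteq> interior G"
    using compact_subset_open_imp_ball_epsilon_subset[of "L \<times> L" "interior G"] L(1)
    by (auto simp: compact_Times)
  define N where "N = (\<Union>x\<in>L. ball x (e / 2))"
  have G: "(p, q) \<in> G" if pq: "p \<in> N" "q \<in> N" for p q
  proof -
    obtain x y where xy: "x \<in> L" "y \<in> L" "dist x p < e / 2" "dist y q < e / 2"
      using pq by (auto simp: N_def)
    have "dist (x, y) (p, q) \<le> dist x p + dist y q"
      unfolding dist_Pair_Pair by (rule sqrt_sum_squares_le_sum) auto
    also have "\<dots> < e" using xy by linarith
    finally have "(p, q) \<in> ball (x, y) e" by simp
    then show ?thesis using e(2) xy interior_subset by blast
  qed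
  show thesis
  proof (rule that)
    show "open N" by (auto simp: N_def)
    show "L \<subseteq> N" using e(1) by (force simp: N_def)
    show "N \<subseteq> D" using G by (auto simp: G_def)
    show "inj_on F N" using G by (auto simp: G_def inj_on_def)
  qed
qed

text \<open>On \<open>K\<close> the inverse of \<open>deriv F\<close> is bounded, so
  \<open>g\<close> is Lipschitz and extends to the closed disc, still as a section. Hence
  \<open>F\<close> is injective on the compact image \<open>L\<close> and on a neighbourhood of it,
  where its inverse is the larger section.\<close>

lemma local_section_extends:
  assumes F: "F holomorphic_on D" "open D" "\<And>z. z \<in> D \<Longrightarrow> deriv F z \<noteq> 0"
    and g: "local_section D F w0 r g" and r: "0 < r"
    and K: "compact K" "K \<subseteq> D" "g ` ball 0 r \<subseteq> K"
  obtains r' g' where "r < r'" "local_section D F w0 r' g'"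
proof -
  have gh: "g holomorphic_on ball 0 r" and g0: "g 0 = w0"
    and Fg: "\<And>x. x \<in> ball 0 r \<Longrightarrow> F (g x) = x"
    using g by (auto simp: local_section_def)
  have contF: "continuous_on D F" using F(1) by (rule holomorphic_on_imp_continuous_on)
  have "continuous_on K (\<lambda>z. inverse (deriv F z))"
    using F K by (intro continuous_on_inverse holomorphic_on_imp_continuous_on
        holomorphic_on_subset[OF holomorphic_deriv[OF F(1,2)]]) auto
  then have "bounded ((\<lambda>z. inverse (deriv F z)) ` K)"
    using K(1) by (intro compact_imp_bounded compact_continuous_image)
  then obtain B where B: "B > 0" "\<And>z. z \<in> K \<Longrightarrow> cmod (inverse (deriv F z)) \<le> B"
    unfolding bounded_pos by auto
  have "cmod (deriv g x) \<le> B" if x: "x \<in> ball 0 r" for x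
  proof -
    have gx: "g x \<in> K" using K(3) x by auto
    then have "((F \<circ> g) has_field_derivative deriv F (g x) * deriv g x) (at x)"
      using K(2) by (intro DERIV_chain holomorphic_derivI[OF gh open_ball x] holomorphic_derivI[OF F(1,2)]) auto
    then have "((\<lambda>y. y) has_field_derivative deriv F (g x) * deriv g x) (at x)"
      by (rule has_field_derivative_transform_within_open[OF _ open_ball x]) (simp add: Fg)
    then have "deriv F (g x) * deriv g x = 1"
      by (rule DERIV_unique) (rule DERIV_ident)
    then have "deriv g x = inverse (deriv F (g x))"
      by (metis inverse_unique)
    then show ?thesis using B(2)[OF gx] by simp
  qed
  then have "B-lipschitz_on (ball 0 r) g"
    using B(1) by (intro lipschitz_onI)
      (auto simp: dist_norm intro!: field_differentiable_bound[of "ball 0 r" g "deriv g"]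
        holomorphic_derivI[OF gh open_ball])
  then obtain h where h: "B-lipschitz_on (closure (ball 0 r)) h" "\<And>x. x \<in> ball 0 r \<Longrightarrow> h x = g x"
    using lipschitz_extend_closure by blast
  have conth: "continuous_on (cball 0 r) h"
    using lipschitz_on_continuous_on[OF h(1)] r by simp
  have cl: "closure (ball 0 r) = (cball 0 r :: complex set)" using r by simp
  \<comment> \<open>Closedness of \<open>K\<close> keeps the boundary values inside
    \<open>D\<close>.\<close>
  have hK: "h ` cball 0 r \<subseteq> K"
    unfolding cl[symmetric]
    by (rule image_closure_subset) (use conth cl h(2) K compact_imp_closed in \<open>auto simp: image_subset_iff\<close>)
  have Fh: "F (h x) = x" if "x \<in> cball 0 r" for x
  proof -
    have "F (h x) - x = 0"
    proof (rule continuous_constant_on_closure[of "ball 0 r" "\<lambda>x. F (h x) - x"])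
      show "continuous_on (closure (ball 0 r)) (\<lambda>x. F (h x) - x)"
        unfolding cl using hK K(2)
        by (intro continuous_intros continuous_on_compose2[OF contF conth]) auto
    qed (use that cl h(2) Fg in auto)
    then show ?thesis by simp
  qed
  define L where "L = h ` cball 0 r"
  have L: "compact L" "L \<subseteq> D" "inj_on F L"
    using hK K(2) Fh compact_continuous_image[OF conth] by (auto simp: L_def inj_on_def)
  obtain N where N: "open N" "L \<subseteq> N" "N \<subseteq> D" "inj_on F N"
    by (rule inj_on_neighbourhood_of_compact[OF F(1,2) _ L]) (use F(3) L(2) in auto)
  have FN: "F holomorphic_on N" using F(1) N(3) holomorphic_on_subset by blast
  obtain g' where g': "g' holomorphic_on F ` N" "\<And>z. z \<in> N \<Longrightarrow> g' (F z) = z"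
    using holomorphic_has_inverse[OF FN N(1,4)] by metis
  have "open (F ` N)" using open_mapping_thm3[OF FN N(1,4)] .
  moreover have "cball 0 r \<subseteq> F ` N"
    using N(2) Fh by (force simp: L_def)
  ultimately obtain e where e: "e > 0" "(\<Union>x\<in>cball 0 r. ball x e) \<subseteq> F ` N"
    using compact_subset_open_imp_ball_epsilon_subset[OF compact_cball] by metis
  have sub: "ball 0 (r + e) \<subseteq> F ` N"
  proof
    fix z :: complex assume z: "z \<in> ball 0 (r + e)"
    show "z \<in> F ` N"
    proof (cases "cmod z \<le> r")
      case True
      then show ?thesis using \<open>cball 0 r \<subseteq> F ` N\<close> by auto
    next
      case False
      \<comment> \<open>The radial projection of \<open>z\<close> to the circle of radius
        \<open>r\<close>, at distance \<open>cmod z - r < e\<close>.\<close>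
      define x where "x = z * complex_of_real (r / cmod z)"
      have "z \<noteq> 0" using False r by auto
      then have xr: "cmod x = r" using False r by (simp add: x_def norm_mult norm_divide)
      have "z - x = z * complex_of_real (1 - r / cmod z)"
        by (simp add: x_def algebra_simps)
      then have "cmod (z - x) = cmod z * \<bar>1 - r / cmod z\<bar>"
        by (simp only: norm_mult norm_of_real)
      moreover have "r / cmod z < 1" using False r by (simp add: divide_simps)
      ultimately have "cmod (z - x) = cmod z * (1 - r / cmod z)" by simp
      then have "cmod (z - x) = cmod z - r"
        using \<open>z \<noteq> 0\<close> by (simp add: right_diff_distrib)
      then have "x \<in> cball 0 r" "z \<in> ball x e"
        using z xr by (auto simp: dist_norm norm_minus_commute)
      then show ?thesis using e(2) by blast
    qed
  qed
  have "h 0 \<in> L" using r by (simp add: L_def)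
  then have "w0 \<in> N" using N(2) h(2)[of 0] g0 r by auto
  moreover have "F w0 = 0" using Fg[of 0] g0 r by simp
  ultimately have "g' 0 = w0" using g'(2) by metis
  moreover have "g' z \<in> D \<and> F (g' z) = z" if "z \<in> ball 0 (r + e)" for z
    using that sub N(3) g'(2) by (auto simp: subset_iff image_iff)
  ultimately have "local_section D F w0 (r + e) g'"
    using holomorphic_on_subset[OF g'(1) sub] by (auto simp: local_section_def)
  then show thesis using that[of "r + e"] e(1) by simp
qed

text \<open>Both sections stay near \<open>w0\<close> for small arguments, where \<open>F\<close> is
  injective; the identity theorem does the rest.\<close>

lemma local_section_unique:
  assumes F: "F holomorphic_on D" "open D" "deriv F w0 \<noteq> 0"
    and g: "local_section D F w0 r g" and h: "local_section D F w0 s h"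
    and z: "cmod z < r" "cmod z < s"
  shows "g z = h z"
proof -
  define t where "t = min r s"
  have t: "0 < t" "z \<in> ball 0 t"
    using z le_less_trans[OF norm_ge_zero] by (auto simp: t_def)
  have gh: "g holomorphic_on ball 0 t" "h holomorphic_on ball 0 t"
    using g h by (auto simp: local_section_def t_def intro: holomorphic_on_subset)
  have eq: "F (g x) = F (h x)" if "x \<in> ball 0 t" for x
    using that g h by (auto simp: local_section_def t_def)
  have 0: "g 0 = w0" "h 0 = w0" using g h by (auto simp: local_section_def)
  have "w0 \<in> D" using g t by (force simp: local_section_def t_def)
  then obtain e where e: "e > 0" "inj_on F (ball w0 e)"
    using has_complex_derivative_locally_injective[OF F(1) _ F(2,3)] by blast
  define U where "U = (ball 0 t \<inter> g -` ball w0 e) \<inter> (ball 0 t \<inter> h -` ball w0 e)"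
  have "open U"
    unfolding U_def using gh by (intro open_Int continuous_open_preimage holomorphic_on_imp_continuous_on) auto
  moreover have "0 \<in> U" using 0 e t by (simp add: U_def)
  moreover have "g x = h x" if "x \<in> U" for x
    using that inj_onD[OF e(2) eq, of x] by (auto simp: U_def)
  moreover have "U \<subseteq> ball 0 t" by (auto simp: U_def)
  ultimately show ?thesis
    using gh t by (intro analytic_continuation_open[of U "ball 0 t" g h z]) auto
qed

lemma local_section_exists:
  assumes F: "F holomorphic_on D" "open D" "w0 \<in> D" "deriv F w0 \<noteq> 0" "F w0 = 0"
  obtains r g where "0 < r" "local_section D F w0 r g"
proof -
  obtain e where e: "e > 0" "ball w0 e \<subseteq> D" "open (F ` ball w0 e)" "inj_on F (ball w0 e)"
    using has_complex_derivative_locally_invertible[OF F(1,3,2,4)] by blast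
  have Fe: "F holomorphic_on ball w0 e" using F(1) e(2) holomorphic_on_subset by blast
  obtain g where g: "g holomorphic_on F ` ball w0 e" "\<And>z. z \<in> ball w0 e \<Longrightarrow> g (F z) = z"
    using holomorphic_has_inverse[OF Fe open_ball e(4)] by metis
  have w0: "w0 \<in> ball w0 e" using e by simp
  then obtain r where r: "r > 0" "ball 0 r \<subseteq> F ` ball w0 e"
    using e(3) F(5) by (metis image_eqI open_contains_ball)
  have "g z \<in> D \<and> F (g z) = z" if "z \<in> ball 0 r" for z
    using that r(2) g(2) e(2) by (auto simp: subset_iff image_iff)
  moreover have "g 0 = w0" using g(2)[OF w0] F(5) by simp
  ultimately have "local_section D F w0 r g"
    using holomorphic_on_subset[OF g(1) r(2)] by (auto simp: local_section_def)
  then show thesis using that r(1) by blast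
qed

section \<open>The global section and the biholomorphism\<close>

text \<open>Sections on all smaller discs glue to one on the disc of the supremal radius. Below
  radius 1 it stays in a compact set and could be extended, against maximality.\<close>

lemma global_section_exists:
  assumes F: "F holomorphic_on D" "open D" "w0 \<in> D" "F w0 = 0" "\<And>z. z \<in> D \<Longrightarrow> deriv F z \<noteq> 0"
    and K: "\<And>r. r < 1 \<Longrightarrow> \<exists>K. compact K \<and> K \<subseteq> D \<and> (\<forall>g. local_section D F w0 r g \<longrightarrow> g ` ball 0 r \<subseteq> K)"
  obtains g where "local_section D F w0 1 g"
proof -
  define S where "S = {r. 0 < r \<and> r \<le> 1 \<and> (\<exists>g. local_section D F w0 r g)}"
  have shrink: "local_section D F w0 s g" if "local_section D F w0 r g" "s \<le> r" for r s g
    using that subset_ball[OF that(2), of "0 :: complex"] unfolding local_section_def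
    by (auto intro: holomorphic_on_subset)
  obtain r0 g0 where "0 < r0" "local_section D F w0 r0 g0"
    using local_section_exists[OF F(1,2,3) F(5)[OF F(3)] F(4)] by blast
  then have min: "min r0 1 \<in> S"
    unfolding S_def using shrink[of r0 g0 "min r0 1"] by (intro CollectI conjI exI[of _ g0]) auto
  have bdd: "bdd_above S" by (rule bdd_aboveI[of _ 1]) (auto simp: S_def)
  define R where "R = Sup S"
  have R1: "R \<le> 1" unfolding R_def using min by (intro cSup_least) (blast, simp add: S_def)
  have SR: "r \<le> R" if "r \<in> S" for r unfolding R_def using that bdd by (rule cSup_upper)
  have R0: "0 < R" using SR[OF min] min by (auto simp: S_def)
  obtain \<gamma> where \<gamma>: "\<And>r. r \<in> S \<Longrightarrow> local_section D F w0 r (\<gamma> r)"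
  proof -
    have "\<forall>r\<in>S. \<exists>g. local_section D F w0 r g" by (auto simp: S_def)
    then show thesis using that bchoice by metis
  qed
  \<comment> \<open>By uniqueness the value does not depend on which admissible radius is
    chosen.\<close>
  define G where "G z = \<gamma> (SOME r. r \<in> S \<and> cmod z < r) z" for z
  have G: "G z = \<gamma> r z" if "r \<in> S" "cmod z < r" for r z
  proof -
    have "(SOME r. r \<in> S \<and> cmod z < r) \<in> S \<and> cmod z < (SOME r. r \<in> S \<and> cmod z < r)"
      using that by (intro someI[of "\<lambda>r. r \<in> S \<and> cmod z < r"]) auto
    then show ?thesis
      unfolding G_def using that by (intro local_section_unique[OF F(1,2) F(5)[OF F(3)] \<gamma> \<gamma>]) auto
  qed
  have ball: "ball 0 R = (\<Union>r\<in>S. ball (0 :: complex) r)"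
    using SR less_cSup_iff[OF _ bdd] min unfolding R_def[symmetric] by fastforce
  have "G holomorphic_on ball 0 R"
    unfolding ball
  proof (rule holomorphic_on_UN_open)
    fix r assume r: "r \<in> S"
    then have "\<gamma> r holomorphic_on ball 0 r" using \<gamma> by (auto simp: local_section_def)
    then show "G holomorphic_on ball 0 r"
      by (rule holomorphic_transform) (use G r in auto)
  qed auto
  moreover have "G z \<in> D \<and> F (G z) = z" if z: "z \<in> ball 0 R" for z
  proof -
    obtain r where r: "r \<in> S" "z \<in> ball 0 r" using z unfolding ball by blast
    then show ?thesis using \<gamma>[OF r(1)] G[OF r(1), of z] by (auto simp: local_section_def)
  qed
  moreover have "G 0 = w0"
    using G[OF min, of 0] \<gamma>[OF min] min by (auto simp: local_section_def S_def)
  ultimately have GR: "local_section D F w0 R G"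
    by (auto simp: local_section_def)
  have "R = 1"
  proof (rule ccontr)
    assume "R \<noteq> 1"
    then have "R < 1" using R1 by simp
    then obtain K where "compact K" "K \<subseteq> D" "G ` ball 0 R \<subseteq> K" using K GR by metis
    then obtain r' g' where r': "R < r'" "local_section D F w0 r' g'"
      using local_section_extends[OF F(1,2,5) GR R0] by blast
    then have "min r' 1 \<in> S"
      unfolding S_def using shrink[of r' g' "min r' 1"] R0 by (intro CollectI conjI exI[of _ g']) auto
    then show False using SR r'(1) \<open>R < 1\<close> by fastforce
  qed
  then show thesis using GR that by simp
qed

text \<open>The image of \<open>g\<close> is open because \<open>g\<close> is injective, and closed
  in \<open>D\<close> because it is the set where \<open>g (F z) = z\<close>; connectedness makes it
  \<open>D\<close>.\<close>

lemma global_section_imp_biholomorphic: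
  assumes D: "open D" "connected D" and F: "F \<in> holo_maps D unit_disc"
    and g: "local_section D F w0 1 g"
  shows "biholomorphic D unit_disc"
proof -
  have Fh: "F holomorphic_on D" "F ` D \<subseteq> unit_disc" using F by (auto simp: holo_maps_def)
  have gh: "g holomorphic_on unit_disc" "g ` unit_disc \<subseteq> D"
    and Fg: "\<And>x. x \<in> unit_disc \<Longrightarrow> F (g x) = x"
    using g by (auto simp: local_section_def)
  have "inj_on g unit_disc" by (metis Fg inj_onI)
  then have "open (g ` unit_disc)" using open_mapping_thm3[OF gh(1) open_ball] by blast
  moreover have im: "g ` unit_disc = {z \<in> D. g (F z) - z = 0}"
    using gh(2) Fg Fh(2) by (force simp: image_subset_iff)
  moreover have "continuous_on D (\<lambda>z. g (F z) - z)"
    using Fh holomorphic_on_imp_continuous_on[OF gh(1)] holomorphic_on_imp_continuous_on[OF Fh(1)]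
    by (intro continuous_intros continuous_on_compose2[of unit_disc g D F]) auto
  then have "closedin (top_of_set D) {z \<in> D. g (F z) - z = 0}"
    by (rule continuous_closedin_preimage_constant)
  ultimately have "g ` unit_disc = {} \<or> g ` unit_disc = D"
    using D(2) gh(2) unfolding connected_clopen by (metis open_subset)
  moreover have "g ` unit_disc \<noteq> {}" by simp
  ultimately have "{z \<in> D. g (F z) - z = 0} = D" using im by metis
  then have "\<forall>z\<in>D. g (F z) = z" by auto
  moreover have "g \<in> holo_maps unit_disc D" using gh by (simp add: holo_maps_def)
  ultimately show ?thesis
    unfolding biholomorphic_def using F Fg by blast
qed

lemma c_finitely_compact_imp_biholomorphic:
  assumes D: "open D" "connected D" "D \<noteq> {}" and fin: "c_finitely_compact D"
    and F0: "F0 \<in> holo_maps D unit_disc" "\<And>w. w \<in> D \<Longrightarrow> carath_extremal D F0 w"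
  shows "biholomorphic D unit_disc"
proof -
  obtain w0 where w0: "w0 \<in> D" using D(3) by blast
  then have Fw0: "cmod (F0 w0) < 1" using F0(1) by (auto simp: holo_maps_def)
  \<comment> \<open>Sections live on discs about 0, so the base point has to be sent to 0.\<close>
  define F where "F = Moebius_function 0 (F0 w0) \<circ> F0"
  have F: "F \<in> holo_maps D unit_disc"
    unfolding F_def by (rule Moebius_comp_holo_maps[OF Fw0 F0(1)])
  have ext: "carath_extremal D F w" if "w \<in> D" for w
    using F0(2)[OF that] hyp_deriv_Moebius_comp[OF D(1) that F0(1) Fw0]
    by (simp add: carath_extremal_def F_def)
  have Fh: "F holomorphic_on D" using F by (simp add: holo_maps_def)
  have F0: "F w0 = 0" by (simp add: F_def Moebius_function_eq_zero)
  have nz: "deriv F z \<noteq> 0" if "z \<in> D" for z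
    using c_finitely_compact_imp_hyp_deriv_nonzero[OF D(1,2) fin that ext[OF that]]
    by (auto simp: hyp_deriv_def)
  have "\<exists>K. compact K \<and> K \<subseteq> D \<and> (\<forall>g. local_section D F w0 r g \<longrightarrow> g ` ball 0 r \<subseteq> K)"
    if r: "r < 1" for r
  proof -
    \<comment> \<open>\<open>r\<close> need not be positive: the maximum keeps \<open>B\<close>
      positive, and the 1 makes the final inequality strict.\<close>
    define B where "B = max 0 (artanh r) + 1"
    let ?K = "closure {z \<in> D. carath_dist D w0 z < B}"
    have "B > 0" by (simp add: B_def)
    then have "compact ?K" "?K \<subseteq> D"
      using fin w0 unfolding c_finitely_compact_def relatively_compact_in_def by blast+
    moreover have "g z \<in> ?K" if g: "local_section D F w0 r g" "z \<in> ball 0 r" for g z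
    proof -
      have "carath_dist D w0 (g z) \<le> artanh (cmod z)"
        using carath_dist_local_section_le[OF D(1) F ext g(1) _ g(2)] r by simp
      also have "\<dots> \<le> artanh r" using g(2) r by (intro artanh_mono) auto
      also have "\<dots> < B" by (simp add: B_def)
      finally show ?thesis
        using g closure_subset by (fastforce simp: local_section_def)
    qed
    ultimately show ?thesis by blast
  qed
  then obtain g where "local_section D F w0 1 g"
    using global_section_exists[OF Fh D(1) w0 F0 nz] by metis
  then show ?thesis using global_section_imp_biholomorphic[OF D(1,2) F] by blast
qed

theorem theorem25:
  fixes D :: "complex set"
  assumes "complex_domain D"
    and "\<exists>C. finite C \<and> universal_set_inf_carath D C"
  shows "(\<exists>C. card C = 1 \<and> universal_set_inf_carath D C) \<and>
         (c_finitely_compact D \<longrightarrow> biholomorphic D unit_disc)"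
proof -
  have D: "open D" "connected D" "D \<noteq> {}"
    using assms(1) by (auto simp: complex_domain_def)
  obtain F where F: "F \<in> holo_maps D unit_disc" "universal_set_inf_carath D {F}"
    using finite_universal_imp_single_universal[OF D] assms(2) by blast
  then have "carath_extremal D F w" if "w \<in> D" for w
    using that universal_set_inf_carath_iff[OF D(1)] by auto
  then have "c_finitely_compact D \<longrightarrow> biholomorphic D unit_disc"
    using c_finitely_compact_imp_biholomorphic[OF D _ F(1)] by blast
  moreover have "\<exists>C. card C = 1 \<and> universal_set_inf_carath D C"
    using F(2) by (intro exI[of _ "{F}"]) simp
  ultimately show ?thesis by blast
qed

end
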